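(* Let Assumptions 1 and 2 of the context hold and let $x_0\in\mathsf X_0$. (a) Let $\{x_k^\star,\lambda_k^i,\mu_k^{i\star}\}$ be a solution of LCS1, and let $u_k^{i\star}=-(R_k^{ii})^{-1}({B_k^i}'\lambda_{k+1}^i-[N_k^i]_i'\mu_k^{i\star})$. Let $\{\bar x_k,e_k^i,\bar\mu_k^i;b_k^i\}$ be the consistent solution of LCS2 (with parameters $\mu_k^{i\star}$) derived from it, as described in the context. Then $u_k^{i\star}=\bar u_k^i$ for all $k\in\mathsf K_l$, $i\in\mathsf N$, where $\bar u_k^i=-(Y_k^i)^{-1}{B_k^i}'E_{k+1}^iA_k\bar x_k-b_k^i+(Y_k^i)^{-1}\beta_k^i$ is the control associated with this solution of LCS2. (b) Conversely, let $\{\bar x_k,e_k^i,\bar\mu_k^i;b_k^i\}$ be a consistent solution of LCS2, with associated control $\bar u_k^i=-(Y_k^i)^{-1}{B_k^i}'E_{k+1}^iA_k\bar x_k-b_k^i+(Y_k^i)^{-1}\beta_k^i$, and let $\{x_k^\star,\lambda_k^i,\mu_k^{i\star}\}$ be the solution of LCS1 derived from it, as described in the context. Then $\bar u_k^i=-(R_k^{ii})^{-1}({B_k^i}'\lambda_{k+1}^i-[N_k^i]_i'\mu_k^{i\star})$ for all $k\in\mathsf K_l$, $i\in\mathsf N$.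
   Context: Notation. A prime denotes transpose; $\|a\|_A:=a'Aa$; $\mathrm{col}\{\cdot\}$ stacks vectors or matrices vertically; $0\le x\perp y\ge0$ means $x\ge0$, $y\ge0$ (componentwise) and $x'y=0$. $\mathsf N=\{1,\dots,N\}$ (players), $\mathsf K=\{0,\dots,K\}$, $\mathsf K_l=\mathsf K\setminus\{K\}$, $-i=\mathsf N\setminus\{i\}$. The game (DGC). The state $x_k\in\mathbb R^n$ evolves as $x_{k+1}=A_kx_k+\sum_{i\in\mathsf N}B_k^iu_k^i$, $k\in\mathsf K_l$, with given $x_0\in\mathbb R^n$, where $A_k\in\mathbb R^{n\times n}$, $B_k^i\in\mathbb R^{n\times m_i}$ and $u_k^i\in\mathbb R^{m_i}$ is player $i$'s action. Put $\mathsf u_k=\mathrm{col}\{u_k^i\}_{i=1}^N\in\mathbb R^m$, $m=\sum_im_i$. Player $i$'s constraints are $M_k^ix_k+N_k^i\mathsf u_k+r_k^i\ge0$, $k\in\mathsf K_l$, with $M_k^i\in\mathbb R^{c_i\times n}$, $N_k^i\in\mathbb R^{c_i\times m}$, $r_k^i\in\mathbb R^{c_i}$; $[N_k^i]_j\in\mathbb R^{c_i\times m_j}$ is the block of columns of $N_k^i$ multiplying $u_k^j$. Player $i$'s strategy is $\mathsf u^i=\mathrm{col}\{u_k^i\}_{k=0}^{K-1}$, and $\mathsf u^{-i}$ collects the strategies of the other players. Player $i$ minimizes $$J^i(\mathsf u^i,\mathsf u^{-i})=\tfrac12\|x_K\|_{Q_K^i}+{p_K^i}'x_K+\tfrac12\sum_{k\in\mathsf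 K_l}\Big(\|x_k\|_{Q_k^i}+2{p_k^i}'x_k+\sum_{j\in\mathsf N}\|u_k^j\|_{R_k^{ij}}\Big),$$ with $Q_k^i\in\mathbb R^{n\times n}$ symmetric, $p_k^i\in\mathbb R^n$, $R_k^{ij}\in\mathbb R^{m_j\times m_j}$, $R_k^{ii}$ symmetric. $R(x_0)$ is the set of joint strategies $(\mathsf u^i,\mathsf u^{-i})\in\mathbb R^{Km}$ for which, with the state generated from $x_0$, all players' constraints hold at all $k\in\mathsf K_l$; $\Omega=\{(x_0,(\mathsf u^i,\mathsf u^{-i})):(\mathsf u^i,\mathsf u^{-i})\in R(x_0)\}$; $\mathsf X_0=\{x_0\in\mathbb R^n: R(x_0)\ne\emptyset\}$. Assumption 1. (i) $\Omega\ne\emptyset$, and for every $x_0\in\mathsf X_0$, $R(x_0)$ is bounded. (ii) The matrices $[N_k^i]_i$, $k\in\mathsf K_l$, $i\in\mathsf N$, have full rank. (iii) The matrices $R_k^{ii}$, $k\in\mathsf K_l$, $i\in\mathsf N$, are positive definite. Assumption 2. For each $i\in\mathsf N$ the backward symmetric matrix Riccati equation $$E_k^i=A_k'E_{k+1}^iA_k+Q_k^i-A_k'E_{k+1}^iB_k^i(Y_k^i)^{-1}{B_k^i}'E_{k+1}^iA_k,\quad E_K^i=Q_K^i,$$ admits a solution $\{E_k^i,\ k\in\mathsf K\}$, and thus the matrices $Y_k^i=R_k^{ii}+{B_k^i}'E_{k+1}^iB_k^i$, $k\in\mathsf K_l$, $i\in\mathsf N$, are invertible. LCS1. A solution of LCS1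 is a collection $\{x_k^\star,\lambda_k^i\in\mathbb R^n,\ k\in\mathsf K,\ \mu_k^{i\star}\in\mathbb R^{c_i},\ k\in\mathsf K_l,\ i\in\mathsf N\}$ such that for all $k\in\mathsf K_l$, $i\in\mathsf N$ $$x_{k+1}^\star=A_kx_k^\star-\sum_{j\in\mathsf N}B_k^j(R_k^{jj})^{-1}\big({B_k^j}'\lambda_{k+1}^j-[N_k^j]_j'\mu_k^{j\star}\big),$$ $$\lambda_k^i=Q_k^ix_k^\star+p_k^i+A_k'\lambda_{k+1}^i-{M_k^i}'\mu_k^{i\star},$$ $$0\le M_k^ix_k^\star-\sum_{j\in\mathsf N}[N_k^i]_j(R_k^{jj})^{-1}\big({B_k^j}'\lambda_{k+1}^j-[N_k^j]_j'\mu_k^{j\star}\big)+r_k^i\ \perp\ \mu_k^{i\star}\ge0,$$ with $x_0^\star=x_0$ and $\lambda_K^i=Q_K^ix_K^\star+p_K^i$. LCS2. Let parameters $\boldsymbol\mu^\star=\{\mu_k^{i\star}\in\mathbb R^{c_i}\}$ be given. A solution of LCS2 with parameters $\boldsymbol\mu^\star$ is a collection $\{\bar x_k,e_k^i\in\mathbb R^n,\ b_k^i\in\mathbb R^{m_i},\ k\in\mathsf K,\ \bar\mu_k^i\in\mathbb R^{c_i},\ k\in\mathsf K_l,\ i\in\mathsf N\}$ such that for all $k\in\mathsf K_l$, $i\in\mathsf N$ $$\bar x_{k+1}=\big(\mathbf I-B_k^i(Y_k^i)^{-1}{B_k^i}'E_{k+1}^i\big)A_k\bar x_k-B_k^ib_k^i+B_k^i(Y_k^i)^{-1}\beta_k^i+\bar\eta_k^i,$$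 $$e_k^i=A_k'e_{k+1}^i+A_k'E_{k+1}^i\bar\eta_k^i-A_k'E_{k+1}^iB_k^ib_k^i+p_k^i-{M_k^i}'\mu_k^{i\star},$$ $$0\le[N_k^i]_i(Y_k^i)^{-1}\beta_k^i+\big(M_k^i-[N_k^i]_i(Y_k^i)^{-1}{B_k^i}'E_{k+1}^iA_k\big)\bar x_k-[N_k^i]_ib_k^i+\bar\alpha_k^i+r_k^i\ \perp\ \bar\mu_k^i\ge0,$$ $$Y_k^ib_k^i={B_k^i}'(E_{k+1}^i\bar\eta_k^i+e_{k+1}^i)-[N_k^i]_i'\mu_k^{i\star},$$ with $\bar x_0=x_0$, $e_K^i=p_K^i$, $b_K^i=0$, where $$\bar\eta_k^i=\sum_{j\in-i}B_k^j\bar u_k^j,\quad \bar\alpha_k^i=\sum_{j\in-i}[N_k^i]_j\bar u_k^j,\quad \bar u_k^i=-(Y_k^i)^{-1}{B_k^i}'E_{k+1}^iA_k\bar x_k-b_k^i+(Y_k^i)^{-1}\beta_k^i,$$ $$\beta_k^i=[N_k^i]_i'(\bar\mu_k^i-\mu_k^{i\star})+\sum_{\tau=k+1}^{K-1}(A_{\tau-1}\cdots A_{k+1}B_k^i)'{M_\tau^i}'(\bar\mu_\tau^i-\mu_\tau^{i\star})$$ (for $\tau=k+1$ the product $A_{\tau-1}\cdots A_{k+1}$ is the identity). The solution is called consistent if $\bar\mu_k^i=\mu_k^{i\star}$ for all $k\in\mathsf K_l$, $i\in\mathsf N$. Derived solutions. From a solution $\{x_k^\star,\lambda_k^i,\mu_k^{i\star}\}$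 of LCS1, the derived consistent solution of LCS2 is given by $\bar x_k=x_k^\star$, $\bar\mu_k^i=\mu_k^{i\star}$, $e_k^i=\lambda_k^i-E_k^ix_k^\star$ ($k\in\mathsf K$), $b_K^i=0$, and for $k\in\mathsf K_l$ $$b_k^i=(Y_k^i)^{-1}\Big({B_k^i}'\big(E_{k+1}^i\sum_{j\in-i}B_k^jv_k^j+e_{k+1}^i\big)-[N_k^i]_i'\mu_k^{i\star}\Big),\quad v_k^j=-(R_k^{jj})^{-1}({B_k^j}'\lambda_{k+1}^j-[N_k^j]_j'\mu_k^{j\star}).$$ From a consistent solution $\{\bar x_k,e_k^i,\bar\mu_k^i;b_k^i\}$ of LCS2, the derived solution of LCS1 is given by $x_k^\star=\bar x_k$, $\mu_k^{i\star}=\bar\mu_k^i$, $\lambda_k^i=E_k^i\bar x_k+e_k^i$ ($k\in\mathsf K$). *)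

theory Defs
  imports
    "Jordan_Normal_Form.Matrix"
    "Jordan_Normal_Form.Gauss_Jordan_Elimination"
    "Jordan_Normal_Form.DL_Rank"
begin

text \<open>
  The dimensions of the controls and of the constraints depend on the player, so vectors and
  matrices with explicit carriers are used. Time-dependent data take the time \<open>k\<close> first and
  the player \<open>i\<close> second; values outside the index ranges are irrelevant.
\<close>

record dgc =
  nplayers :: nat
  horizon :: nat
  xdim :: nat
  udim :: "nat \<Rightarrow> nat"
  cdim :: "nat \<Rightarrow> nat"
  Amat :: "nat \<Rightarrow> real mat"
  Bmat :: "nat \<Rightarrow> nat \<Rightarrow> real mat"
  Mmat :: "nat \<Rightarrow> nat \<Rightarrow> real mat"
  Nmat :: "nat \<Rightarrow> nat \<Rightarrow> real mat"
  rvec :: "nat \<Rightarrow> nat \<Rightarrow> real vec"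
  Qmat :: "nat \<Rightarrow> nat \<Rightarrow> real mat"
  pvec :: "nat \<Rightarrow> nat \<Rightarrow> real vec"
  Rmat :: "nat \<Rightarrow> nat \<Rightarrow> nat \<Rightarrow> real mat"

definition players :: "dgc \<Rightarrow> nat set" where
  "players G = {1..nplayers G}"

definition total_udim :: "dgc \<Rightarrow> nat" where
  "total_udim G = (\<Sum>i\<in>players G. udim G i)"

definition is_dgc :: "dgc \<Rightarrow> bool" where
  "is_dgc G \<longleftrightarrow>
     nplayers G \<ge> 1 \<and>
     (\<forall>k<horizon G. Amat G k \<in> carrier_mat (xdim G) (xdim G)) \<and>
     (\<forall>k<horizon G. \<forall>i\<in>players G.
        Bmat G k i \<in> carrier_mat (xdim G) (udim G i) \<and>
        Mmat G k i \<in> carrier_mat (cdim G i) (xdim G) \<and>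
        Nmat G k i \<in> carrier_mat (cdim G i) (total_udim G) \<and>
        rvec G k i \<in> carrier_vec (cdim G i) \<and>
        (\<forall>j\<in>players G. Rmat G k i j \<in> carrier_mat (udim G j) (udim G j)) \<and>
        transpose_mat (Rmat G k i i) = Rmat G k i i) \<and>
     (\<forall>k\<le>horizon G. \<forall>i\<in>players G.
        Qmat G k i \<in> carrier_mat (xdim G) (xdim G) \<and>
        transpose_mat (Qmat G k i) = Qmat G k i \<and>
        pvec G k i \<in> carrier_vec (xdim G))"

text \<open>The block \<open>[N_k^i]_j\<close>: the columns of \<open>N_k^i\<close> that multiply \<open>u_k^j\<close>.\<close>

definition Nblock :: "dgc \<Rightarrow> nat \<Rightarrow> nat \<Rightarrow> nat \<Rightarrow> real mat" where
  "Nblock G k i j =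
     mat (cdim G i) (udim G j) (\<lambda>(a, b). Nmat G k i $$ (a, (\<Sum>l\<in>{1..<j}. udim G l) + b))"

text \<open>\<open>finsum_vec\<close> is only meaningful for summands of the stated dimension.\<close>

abbreviation vsum :: "nat \<Rightarrow> ('i \<Rightarrow> real vec) \<Rightarrow> 'i set \<Rightarrow> real vec" where
  "vsum d f S \<equiv> finsum_vec TYPE(real) d f S"

text \<open>The inverse of a real square matrix; only meaningful if the matrix is invertible.\<close>

definition minv :: "real mat \<Rightarrow> real mat" where
  "minv X = the (mat_inverse X)"

definition positive_definite :: "nat \<Rightarrow> real mat \<Rightarrow> bool" where
  "positive_definite d X \<longleftrightarrow> (\<forall>v\<in>carrier_vec d. v \<noteq> 0\<^sub>v d \<longrightarrow> v \<bullet> (X *\<^sub>v v) > 0)"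

definition full_rank :: "real mat \<Rightarrow> bool" where
  "full_rank X \<longleftrightarrow> vec_space.rank (dim_row X) X = min (dim_row X) (dim_col X)"

definition perp_nonneg :: "nat \<Rightarrow> real vec \<Rightarrow> real vec \<Rightarrow> bool" where
  "perp_nonneg d v w \<longleftrightarrow> 0\<^sub>v d \<le> v \<and> 0\<^sub>v d \<le> w \<and> v \<bullet> w = 0"

definition vcol :: "real vec list \<Rightarrow> real vec" where
  "vcol vs = vec_of_list (concat (map list_of_vec vs))"

definition stage_control :: "dgc \<Rightarrow> (nat \<Rightarrow> nat \<Rightarrow> real vec) \<Rightarrow> nat \<Rightarrow> real vec" where
  "stage_control G u k = vcol (map (u k) [1..<Suc (nplayers G)])"

definition player_strategy :: "dgc \<Rightarrow> (nat \<Rightarrow> nat \<Rightarrow> real vec) \<Rightarrow> nat \<Rightarrow> real vec" where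
  "player_strategy G u i = vcol (map (\<lambda>k. u k i) [0..<horizon G])"

definition joint_strategy :: "dgc \<Rightarrow> (nat \<Rightarrow> nat \<Rightarrow> real vec) \<Rightarrow> real vec" where
  "joint_strategy G u = vcol (map (player_strategy G u) [1..<Suc (nplayers G)])"

fun state :: "dgc \<Rightarrow> real vec \<Rightarrow> (nat \<Rightarrow> nat \<Rightarrow> real vec) \<Rightarrow> nat \<Rightarrow> real vec" where
  "state G x0 u 0 = x0"
| "state G x0 u (Suc k) =
     Amat G k *\<^sub>v state G x0 u k + vsum (xdim G) (\<lambda>i. Bmat G k i *\<^sub>v u k i) (players G)"

definition Rset :: "dgc \<Rightarrow> real vec \<Rightarrow> real vec set" where
  "Rset G x0 = {joint_strategy G u | u.
     (\<forall>k<horizon G. \<forall>i\<in>players G.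
        u k i \<in> carrier_vec (udim G i) \<and>
        0\<^sub>v (cdim G i) \<le>
          Mmat G k i *\<^sub>v state G x0 u k + Nmat G k i *\<^sub>v stage_control G u k + rvec G k i)}"

definition Omega :: "dgc \<Rightarrow> (real vec \<times> real vec) set" where
  "Omega G = {(x0, U). x0 \<in> carrier_vec (xdim G) \<and> U \<in> Rset G x0}"

definition X0set :: "dgc \<Rightarrow> real vec set" where
  "X0set G = {x0 \<in> carrier_vec (xdim G). Rset G x0 \<noteq> {}}"

text \<open>Boundedness with respect to the (squared) Euclidean norm.\<close>

definition bounded_vecs :: "real vec set \<Rightarrow> bool" where
  "bounded_vecs S \<longleftrightarrow> (\<exists>C. \<forall>v\<in>S. v \<bullet> v \<le> C)"

definition assumption1 :: "dgc \<Rightarrow> bool" where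
  "assumption1 G \<longleftrightarrow>
     Omega G \<noteq> {} \<and> (\<forall>x0\<in>X0set G. bounded_vecs (Rset G x0)) \<and>
     (\<forall>k<horizon G. \<forall>i\<in>players G. full_rank (Nblock G k i i)) \<and>
     (\<forall>k<horizon G. \<forall>i\<in>players G. positive_definite (udim G i) (Rmat G k i i))"

definition Ymat :: "dgc \<Rightarrow> (nat \<Rightarrow> nat \<Rightarrow> real mat) \<Rightarrow> nat \<Rightarrow> nat \<Rightarrow> real mat" where
  "Ymat G E k i = Rmat G k i i + transpose_mat (Bmat G k i) * E (Suc k) i * Bmat G k i"

text \<open>
  \<open>E\<close> solves the backward Riccati equations, where the inverses occurring in them exist. Given
  the symmetry of \<open>Q\<close> and \<open>R\<close>, the matrices \<open>E k i\<close> are determined uniquely and are symmetric.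
\<close>

definition riccati_solution :: "dgc \<Rightarrow> (nat \<Rightarrow> nat \<Rightarrow> real mat) \<Rightarrow> bool" where
  "riccati_solution G E \<longleftrightarrow>
     (\<forall>i\<in>players G.
        (\<forall>k\<le>horizon G. E k i \<in> carrier_mat (xdim G) (xdim G)) \<and>
        E (horizon G) i = Qmat G (horizon G) i \<and>
        (\<forall>k<horizon G.
           invertible_mat (Ymat G E k i) \<and>
           E k i =
             transpose_mat (Amat G k) * E (Suc k) i * Amat G k + Qmat G k i
             - transpose_mat (Amat G k) * E (Suc k) i * Bmat G k i * minv (Ymat G E k i)
               * transpose_mat (Bmat G k i) * E (Suc k) i * Amat G k))"

definition LCS1_control ::
  "dgc \<Rightarrow> (nat \<Rightarrow> nat \<Rightarrow> real vec) \<Rightarrow> (nat \<Rightarrow> nat \<Rightarrow> real vec) \<Rightarrow> nat \<Rightarrow> nat \<Rightarrow> real vec" where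
  "LCS1_control G lam mu k i =
     - (minv (Rmat G k i i) *\<^sub>v
         (transpose_mat (Bmat G k i) *\<^sub>v lam (Suc k) i
          - transpose_mat (Nblock G k i i) *\<^sub>v mu k i))"

definition LCS1_solution ::
  "dgc \<Rightarrow> real vec \<Rightarrow> (nat \<Rightarrow> real vec) \<Rightarrow> (nat \<Rightarrow> nat \<Rightarrow> real vec) \<Rightarrow> (nat \<Rightarrow> nat \<Rightarrow> real vec) \<Rightarrow> bool"
  where
  "LCS1_solution G x0 x lam mu \<longleftrightarrow>
     (\<forall>k\<le>horizon G. x k \<in> carrier_vec (xdim G)) \<and>
     (\<forall>k\<le>horizon G. \<forall>i\<in>players G. lam k i \<in> carrier_vec (xdim G)) \<and>
     (\<forall>k<horizon G. \<forall>i\<in>players G. mu k i \<in> carrier_vec (cdim G i)) \<and>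
     x 0 = x0 \<and>
     (\<forall>i\<in>players G. lam (horizon G) i =
        Qmat G (horizon G) i *\<^sub>v x (horizon G) + pvec G (horizon G) i) \<and>
     (\<forall>k<horizon G. \<forall>i\<in>players G.
        x (Suc k) = Amat G k *\<^sub>v x k
          - vsum (xdim G) (\<lambda>j. Bmat G k j *\<^sub>v (minv (Rmat G k j j) *\<^sub>v
              (transpose_mat (Bmat G k j) *\<^sub>v lam (Suc k) j
               - transpose_mat (Nblock G k j j) *\<^sub>v mu k j))) (players G) \<and>
        lam k i = Qmat G k i *\<^sub>v x k + pvec G k i + transpose_mat (Amat G k) *\<^sub>v lam (Suc k) i
          - transpose_mat (Mmat G k i) *\<^sub>v mu k i \<and>
        perp_nonneg (cdim G i)
          (Mmat G k i *\<^sub>v x k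
           - vsum (cdim G i) (\<lambda>j. Nblock G k i j *\<^sub>v (minv (Rmat G k j j) *\<^sub>v
               (transpose_mat (Bmat G k j) *\<^sub>v lam (Suc k) j
                - transpose_mat (Nblock G k j j) *\<^sub>v mu k j))) (players G)
           + rvec G k i)
          (mu k i))"

text \<open>\<open>Aprod G k d\<close> is the product \<open>A_{k+d} \<cdots> A_{k+1}\<close>, the identity for \<open>d = 0\<close>.\<close>

fun Aprod :: "dgc \<Rightarrow> nat \<Rightarrow> nat \<Rightarrow> real mat" where
  "Aprod G k 0 = 1\<^sub>m (xdim G)"
| "Aprod G k (Suc d) = Amat G (k + Suc d) * Aprod G k d"

definition beta ::
  "dgc \<Rightarrow> (nat \<Rightarrow> nat \<Rightarrow> real vec) \<Rightarrow> (nat \<Rightarrow> nat \<Rightarrow> real vec) \<Rightarrow> nat \<Rightarrow> nat \<Rightarrow> real vec" where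
  "beta G mustar mubar k i =
     transpose_mat (Nblock G k i i) *\<^sub>v (mubar k i - mustar k i)
     + vsum (udim G i)
         (\<lambda>\<tau>. transpose_mat (Aprod G k (\<tau> - Suc k) * Bmat G k i) *\<^sub>v
                (transpose_mat (Mmat G \<tau> i) *\<^sub>v (mubar \<tau> i - mustar \<tau> i)))
         {Suc k..<horizon G}"

definition LCS2_control ::
  "dgc \<Rightarrow> (nat \<Rightarrow> nat \<Rightarrow> real mat) \<Rightarrow> (nat \<Rightarrow> nat \<Rightarrow> real vec) \<Rightarrow> (nat \<Rightarrow> real vec) \<Rightarrow>
   (nat \<Rightarrow> nat \<Rightarrow> real vec) \<Rightarrow> (nat \<Rightarrow> nat \<Rightarrow> real vec) \<Rightarrow> nat \<Rightarrow> nat \<Rightarrow> real vec" where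
  "LCS2_control G E mustar xbar b mubar k i =
     - (minv (Ymat G E k i) *\<^sub>v (transpose_mat (Bmat G k i) *\<^sub>v
          (E (Suc k) i *\<^sub>v (Amat G k *\<^sub>v xbar k))))
     - b k i + minv (Ymat G E k i) *\<^sub>v beta G mustar mubar k i"

definition eta_of :: "dgc \<Rightarrow> (nat \<Rightarrow> nat \<Rightarrow> real vec) \<Rightarrow> nat \<Rightarrow> nat \<Rightarrow> real vec" where
  "eta_of G u k i = vsum (xdim G) (\<lambda>j. Bmat G k j *\<^sub>v u k j) (players G - {i})"

definition alpha_of :: "dgc \<Rightarrow> (nat \<Rightarrow> nat \<Rightarrow> real vec) \<Rightarrow> nat \<Rightarrow> nat \<Rightarrow> real vec" where
  "alpha_of G u k i = vsum (cdim G i) (\<lambda>j. Nblock G k i j *\<^sub>v u k j) (players G - {i})"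

definition LCS2_solution ::
  "dgc \<Rightarrow> (nat \<Rightarrow> nat \<Rightarrow> real mat) \<Rightarrow> real vec \<Rightarrow> (nat \<Rightarrow> nat \<Rightarrow> real vec) \<Rightarrow> (nat \<Rightarrow> real vec) \<Rightarrow>
   (nat \<Rightarrow> nat \<Rightarrow> real vec) \<Rightarrow> (nat \<Rightarrow> nat \<Rightarrow> real vec) \<Rightarrow> (nat \<Rightarrow> nat \<Rightarrow> real vec) \<Rightarrow> bool" where
  "LCS2_solution G E x0 mustar xbar e b mubar \<longleftrightarrow>
     (\<forall>k<horizon G. \<forall>i\<in>players G. mustar k i \<in> carrier_vec (cdim G i)) \<and>
     (\<forall>k\<le>horizon G. xbar k \<in> carrier_vec (xdim G)) \<and>
     (\<forall>k\<le>horizon G. \<forall>i\<in>players G. e k i \<in> carrier_vec (xdim G)) \<and>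
     (\<forall>k\<le>horizon G. \<forall>i\<in>players G. b k i \<in> carrier_vec (udim G i)) \<and>
     (\<forall>k<horizon G. \<forall>i\<in>players G. mubar k i \<in> carrier_vec (cdim G i)) \<and>
     xbar 0 = x0 \<and>
     (\<forall>i\<in>players G. e (horizon G) i = pvec G (horizon G) i) \<and>
     (\<forall>i\<in>players G. b (horizon G) i = 0\<^sub>v (udim G i)) \<and>
     (\<forall>k<horizon G. \<forall>i\<in>players G.
        let A = Amat G k; B = Bmat G k i; E' = E (Suc k) i; Y = Ymat G E k i;
            M = Mmat G k i; N = Nblock G k i i;
            ubar = LCS2_control G E mustar xbar b mubar;
            \<eta> = eta_of G ubar k i; \<alpha> = alpha_of G ubar k i; \<beta> = beta G mustar mubar k i
        in
          xbar (Suc k) =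
            ((1\<^sub>m (xdim G) - B * minv Y * transpose_mat B * E') * A) *\<^sub>v xbar k
            - B *\<^sub>v b k i + B *\<^sub>v (minv Y *\<^sub>v \<beta>) + \<eta> \<and>
          e k i =
            transpose_mat A *\<^sub>v e (Suc k) i + transpose_mat A *\<^sub>v (E' *\<^sub>v \<eta>)
            - transpose_mat A *\<^sub>v (E' *\<^sub>v (B *\<^sub>v b k i)) + pvec G k i
            - transpose_mat M *\<^sub>v mustar k i \<and>
          perp_nonneg (cdim G i)
            (N *\<^sub>v (minv Y *\<^sub>v \<beta>)
             + (M - N * minv Y * transpose_mat B * E' * A) *\<^sub>v xbar k
             - N *\<^sub>v b k i + \<alpha> + rvec G k i)
            (mubar k i) \<and>
          Y *\<^sub>v b k i =
            transpose_mat B *\<^sub>v (E' *\<^sub>v \<eta> + e (Suc k) i) - transpose_mat N *\<^sub>v mustar k i)"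

definition LCS2_consistent_solution ::
  "dgc \<Rightarrow> (nat \<Rightarrow> nat \<Rightarrow> real mat) \<Rightarrow> real vec \<Rightarrow> (nat \<Rightarrow> nat \<Rightarrow> real vec) \<Rightarrow> (nat \<Rightarrow> real vec) \<Rightarrow>
   (nat \<Rightarrow> nat \<Rightarrow> real vec) \<Rightarrow> (nat \<Rightarrow> nat \<Rightarrow> real vec) \<Rightarrow> (nat \<Rightarrow> nat \<Rightarrow> real vec) \<Rightarrow> bool" where
  "LCS2_consistent_solution G E x0 mustar xbar e b mubar \<longleftrightarrow>
     LCS2_solution G E x0 mustar xbar e b mubar \<and>
     (\<forall>k<horizon G. \<forall>i\<in>players G. mubar k i = mustar k i)"

text \<open>
  The next two predicates relate a solution of one system to the one derived from it. They only
  consist of the defining formulas, not of the claim that a solution is obtained.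
\<close>

definition LCS2_derived_from_LCS1 ::
  "dgc \<Rightarrow> (nat \<Rightarrow> nat \<Rightarrow> real mat) \<Rightarrow>
   (nat \<Rightarrow> real vec) \<Rightarrow> (nat \<Rightarrow> nat \<Rightarrow> real vec) \<Rightarrow> (nat \<Rightarrow> nat \<Rightarrow> real vec) \<Rightarrow>
   (nat \<Rightarrow> real vec) \<Rightarrow> (nat \<Rightarrow> nat \<Rightarrow> real vec) \<Rightarrow> (nat \<Rightarrow> nat \<Rightarrow> real vec) \<Rightarrow>
   (nat \<Rightarrow> nat \<Rightarrow> real vec) \<Rightarrow> bool" where
  "LCS2_derived_from_LCS1 G E x lam mu xbar e b mubar \<longleftrightarrow>
     (\<forall>k\<le>horizon G. xbar k = x k) \<and>
     (\<forall>k<horizon G. \<forall>i\<in>players G. mubar k i = mu k i) \<and>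
     (\<forall>k\<le>horizon G. \<forall>i\<in>players G. e k i = lam k i - E k i *\<^sub>v x k) \<and>
     (\<forall>i\<in>players G. b (horizon G) i = 0\<^sub>v (udim G i)) \<and>
     (\<forall>k<horizon G. \<forall>i\<in>players G.
        b k i = minv (Ymat G E k i) *\<^sub>v
          (transpose_mat (Bmat G k i) *\<^sub>v
             (E (Suc k) i *\<^sub>v eta_of G (LCS1_control G lam mu) k i + e (Suc k) i)
           - transpose_mat (Nblock G k i i) *\<^sub>v mu k i))"

definition LCS1_derived_from_LCS2 ::
  "dgc \<Rightarrow> (nat \<Rightarrow> nat \<Rightarrow> real mat) \<Rightarrow>
   (nat \<Rightarrow> real vec) \<Rightarrow> (nat \<Rightarrow> nat \<Rightarrow> real vec) \<Rightarrow> (nat \<Rightarrow> nat \<Rightarrow> real vec) \<Rightarrow>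
   (nat \<Rightarrow> real vec) \<Rightarrow> (nat \<Rightarrow> nat \<Rightarrow> real vec) \<Rightarrow> (nat \<Rightarrow> nat \<Rightarrow> real vec) \<Rightarrow> bool" where
  "LCS1_derived_from_LCS2 G E xbar e mubar x lam mu \<longleftrightarrow>
     (\<forall>k\<le>horizon G. x k = xbar k) \<and>
     (\<forall>k<horizon G. \<forall>i\<in>players G. mu k i = mubar k i) \<and>
     (\<forall>k\<le>horizon G. \<forall>i\<in>players G. lam k i = E k i *\<^sub>v xbar k + e k i)"

end

theory Submission
  imports Defs
begin

text \<open>Fix a stage k and a player i, write E and e for the data at time k + 1, and let eta be
  the contribution of the other players to the next state. Substitute lambda = E x_{k+1} + e and
  x_{k+1} = A x + B u + eta into R u + B' lambda - N' mu. The term B' E B u joins R u, so R turns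
  into Y = R + B' E B, and the equation for b absorbs the terms in eta, e and mu. This gives the
  identity R u + B' lambda - N' mu = Y u + Y b + B' E A x. The LCS1 control formula says that the
  left side vanishes; the LCS2 formula, in which consistency makes beta zero, says that the right
  side vanishes. So a control that generates the next state and satisfies one formula also satisfies
  the other (\<open>control_iff\<close>, \<open>controls_agree\<close>). Part (a) applies this to
  the LCS1 control, part (b) to the LCS2 control. Once the controls agree, the state equations and
  the constraints of the two systems become the same expressions (\<open>LCS1_sums\<close>,
  \<open>LCS2_sums\<close>). By the Riccati equation, the LCS1 costate equation is the LCS2
  recursion for e with E_k x_k added to both sides (\<open>costate_iff\<close>). With E_K = Q_K at
  the horizon this yields \<open>lcs_iff\<close>, so the derived data do solve the other
  system.\<close>

section \<open>Matrix-vector algebra\<close>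

text \<open>Dimension premises instead of carrier premises, so that the laws work as rewrite rules.\<close>

lemma mult_mat_vec_add:
  fixes A :: "'a :: semiring_0 mat"
  assumes "dim_vec v = dim_col A" and "dim_vec w = dim_col A"
  shows "A *\<^sub>v (v + w) = A *\<^sub>v v + A *\<^sub>v w"
  by (rule mult_add_distrib_mat_vec[of _ "dim_row A" "dim_col A"])
     (use assms in \<open>auto intro: carrier_vecI\<close>)

lemma mult_mat_vec_minus:
  fixes A :: "'a :: ring mat"
  assumes "dim_vec v = dim_col A" and "dim_vec w = dim_col A"
  shows "A *\<^sub>v (v - w) = A *\<^sub>v v - A *\<^sub>v w"
  by (rule mult_minus_distrib_mat_vec[of _ "dim_row A" "dim_col A"])
     (use assms in \<open>auto intro: carrier_vecI\<close>)

lemma mult_mat_vec_uminus: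
  fixes A :: "'a :: ring mat"
  assumes "dim_vec v = dim_col A"
  shows "A *\<^sub>v (- v) = - (A *\<^sub>v v)"
  by (rule eq_vecI) (use assms in \<open>auto simp: scalar_prod_def sum_negf\<close>)

lemma add_mult_mat_vec:
  fixes A :: "'a :: semiring_0 mat"
  assumes "dim_row A = dim_row B" and "dim_col A = dim_col B" and "dim_vec v = dim_col B"
  shows "(A + B) *\<^sub>v v = A *\<^sub>v v + B *\<^sub>v v"
  by (rule add_mult_distrib_mat_vec[of _ "dim_row B" "dim_col B"])
     (use assms in \<open>auto intro: carrier_vecI\<close>)

lemma minus_mult_mat_vec:
  fixes A :: "'a :: ring mat"
  assumes "dim_row A = dim_row B" and "dim_col A = dim_col B" and "dim_vec v = dim_col B"
  shows "(A - B) *\<^sub>v v = A *\<^sub>v v - B *\<^sub>v v"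
  by (rule minus_mult_distrib_mat_vec[of _ "dim_row B" "dim_col B"])
     (use assms in \<open>auto intro: carrier_vecI\<close>)

lemma mult_mult_mat_vec:
  fixes A :: "'a :: semiring_0 mat"
  assumes "dim_col A = dim_row B" and "dim_vec v = dim_col B"
  shows "(A * B) *\<^sub>v v = A *\<^sub>v (B *\<^sub>v v)"
  by (rule assoc_mult_mat_vec[of _ "dim_row A" "dim_col A" _ "dim_col B"])
     (use assms in \<open>auto intro: carrier_vecI\<close>)

lemma one_mult_mat_vec_dim: "dim_vec v = n \<Longrightarrow> 1\<^sub>m n *\<^sub>v v = (v :: 'a :: semiring_1 vec)"
  by (rule one_mult_mat_vec) (rule carrier_vecI)

lemma mult_mat_vec_zero:
  fixes A :: "'a :: semiring_0 mat"
  assumes "dim_col A = d" and "dim_row A = r"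
  shows "A *\<^sub>v 0\<^sub>v d = 0\<^sub>v r"
  by (rule eq_vecI) (use assms in \<open>auto simp: scalar_prod_def\<close>)

text \<open>As rewrite rules these expand both sides of an identity into sums of iterated products
  of matrices with a single vector.\<close>

lemmas mat_vec_distribs =
  mult_mat_vec_add mult_mat_vec_minus mult_mat_vec_uminus add_mult_mat_vec minus_mult_mat_vec
  mult_mult_mat_vec one_mult_mat_vec_dim

section \<open>Inverses of real square matrices\<close>

lemma minv_unit:
  assumes "X \<in> Units (ring_mat TYPE(real) d ())"
  shows "minv X \<in> carrier_mat d d" and "X * minv X = 1\<^sub>m d" and "minv X * X = 1\<^sub>m d"
proof -
  have X: "X \<in> carrier_mat d d"
    using assms by (auto simp: Units_def ring_mat_simps)
  obtain Z where Z: "mat_inverse X = Some Z"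
    using mat_inverse(1)[OF X, of "()"] assms by (cases "mat_inverse X") simp_all
  show "minv X \<in> carrier_mat d d" "X * minv X = 1\<^sub>m d" "minv X * X = 1\<^sub>m d"
    using mat_inverse(2)[OF X Z] by (simp_all add: minv_def Z)
qed

text \<open>Used to trade every control formula containing an inverse for a linear system.\<close>

lemma minv_mult_vec_eq_iff:
  assumes "X \<in> Units (ring_mat TYPE(real) d ())" and "v \<in> carrier_vec d" and "w \<in> carrier_vec d"
  shows "minv X *\<^sub>v w = v \<longleftrightarrow> X *\<^sub>v v = w"
proof -
  have X: "X \<in> carrier_mat d d"
    using assms(1) by (auto simp: Units_def ring_mat_simps)
  note inv = minv_unit[OF assms(1)]
  show ?thesis
    using assms(2,3) assoc_mult_mat_vec[OF X inv(1), of w] assoc_mult_mat_vec[OF inv(1) X, of v] inv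
    by auto
qed

text \<open>The predicate \<open>invertible_mat\<close> does not state the dimensions of the
  inverse; comparing dimensions in the two product equations recovers them.\<close>

lemma invertible_mat_unit:
  assumes "invertible_mat X" and X: "X \<in> carrier_mat d d"
  shows "X \<in> Units (ring_mat TYPE(real) d ())"
proof -
  obtain Z where Z: "X * Z = 1\<^sub>m (dim_row X)" "Z * X = 1\<^sub>m (dim_row Z)"
    using assms(1) by (auto simp: invertible_mat_def inverts_mat_def)
  have "dim_row Z = d" "dim_col Z = d"
    using arg_cong[OF Z(2), of dim_col] arg_cong[OF Z(1), of dim_col] X by auto
  then show ?thesis
    using X Z by (auto simp: Units_def ring_mat_simps intro!: bexI[of _ Z])
qed

text \<open>A singular matrix has a nonzero kernel vector, at which the quadratic form would be
  zero.\<close>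

lemma positive_definite_unit:
  assumes "positive_definite d X" and X: "X \<in> carrier_mat d d"
  shows "X \<in> Units (ring_mat TYPE(real) d ())"
proof (rule det_non_zero_imp_unit[OF X])
  show "det X \<noteq> 0"
    using assms(1) det_0_iff_vec_prod_zero_field[OF X] by (force simp: positive_definite_def)
qed

section \<open>Finite sums of vectors\<close>

lemma finsum_vec_cong:
  assumes "\<And>j. j \<in> S \<Longrightarrow> f j = g j" and "\<And>j. j \<in> S \<Longrightarrow> g j \<in> carrier_vec d"
  shows "finsum_vec TYPE('a :: comm_monoid_add) d f S = finsum_vec TYPE('a) d g S"
  unfolding finsum_vec_def
  by (rule comm_monoid.finprod_cong'[OF comm_monoid_vec]) (use assms in \<open>auto simp: monoid_vec_simps\<close>)

lemma finsum_vec_remove: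
  assumes "finite S" and "i \<in> S" and "\<And>j. j \<in> S \<Longrightarrow> f j \<in> carrier_vec d"
  shows "finsum_vec TYPE('a :: comm_monoid_add) d f S = f i + finsum_vec TYPE('a) d f (S - {i})"
  using finsum_vec_insert[of "S - {i}" i f d] assms by (auto simp: insert_absorb)

lemma dim_finsum_vec:
  assumes "\<And>j. j \<in> S \<Longrightarrow> f j \<in> carrier_vec d"
  shows "dim_vec (finsum_vec TYPE('a :: comm_monoid_add) d f S) = d"
  using finsum_vec_closed[of f S d] assms by auto

lemma finsum_vec_uminus:
  assumes "finite S" and "\<And>j. j \<in> S \<Longrightarrow> f j \<in> carrier_vec d"
  shows "finsum_vec TYPE('a :: ab_group_add) d (\<lambda>j. - f j) S = - finsum_vec TYPE('a) d f S"
proof (rule eq_vecI)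
  fix a assume "a < dim_vec (- finsum_vec TYPE('a) d f S)"
  then have a: "a < d"
    using assms by (simp add: dim_finsum_vec)
  have "(\<Sum>j\<in>S. (- f j) $ a) = (\<Sum>j\<in>S. - (f j $ a))"
    using assms(2) a by (intro sum.cong refl index_uminus_vec(1)) (auto dest: carrier_vecD)
  then show "finsum_vec TYPE('a) d (\<lambda>j. - f j) S $ a = (- finsum_vec TYPE('a) d f S) $ a"
    using assms a by (simp add: dim_finsum_vec index_finsum_vec sum_negf Pi_iff)
qed (use assms in \<open>simp add: dim_finsum_vec\<close>)

lemma finsum_vec_zero: "finsum_vec TYPE('a :: comm_monoid_add) d (\<lambda>j. 0\<^sub>v d) S = 0\<^sub>v d"
  unfolding finsum_vec_def
  using comm_monoid.finprod_one[OF comm_monoid_vec, of d S] by (simp add: monoid_vec_simps)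

section \<open>One stage of the Riccati recursion for one player\<close>

text \<open>\<open>E1\<close> and \<open>E0\<close> are the Riccati matrices at times \<open>k + 1\<close> and \<open>k\<close>.\<close>

locale riccati_stage =
  fixes n m c :: nat and A B E1 E0 Q R M N :: "real mat"
  assumes A: "A \<in> carrier_mat n n" and B: "B \<in> carrier_mat n m"
    and E1: "E1 \<in> carrier_mat n n" and E0: "E0 \<in> carrier_mat n n"
    and Q: "Q \<in> carrier_mat n n" and R: "R \<in> carrier_mat m m"
    and M: "M \<in> carrier_mat c n" and N: "N \<in> carrier_mat c m"
    and R_unit: "R \<in> Units (ring_mat TYPE(real) m ())"
    and Y_unit: "R + transpose_mat B * E1 * B \<in> Units (ring_mat TYPE(real) m ())"
    and riccati: "E0 = transpose_mat A * E1 * A + Q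
      - transpose_mat A * E1 * B * minv (R + transpose_mat B * E1 * B) * transpose_mat B * E1 * A"
begin

abbreviation "Y \<equiv> R + transpose_mat B * E1 * B"

lemma minv_Y: "minv Y \<in> carrier_mat m m"
  using minv_unit(1)[OF Y_unit] .

lemmas dims [simp] =
  A[THEN carrier_matD(1)] A[THEN carrier_matD(2)] B[THEN carrier_matD(1)] B[THEN carrier_matD(2)]
  E1[THEN carrier_matD(1)] E1[THEN carrier_matD(2)] E0[THEN carrier_matD(1)] E0[THEN carrier_matD(2)]
  Q[THEN carrier_matD(1)] Q[THEN carrier_matD(2)] R[THEN carrier_matD(1)] R[THEN carrier_matD(2)]
  M[THEN carrier_matD(1)] M[THEN carrier_matD(2)] N[THEN carrier_matD(1)] N[THEN carrier_matD(2)]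
  minv_Y[THEN carrier_matD(1)] minv_Y[THEN carrier_matD(2)]

text \<open>
  Both control formulas say that \<open>u\<close> solves a linear system, with matrix \<open>R\<close> resp. \<open>Y\<close>. Inserting
  \<open>\<lambda> = E x + e\<close> at time \<open>k + 1\<close> and the state equation turns one system into the other.
\<close>

lemma control_iff:
  assumes [simp]: "dim_vec x = n" "dim_vec u = m" "dim_vec \<eta> = n" "dim_vec b = m" "dim_vec e1 = n"
      "dim_vec \<mu> = c"
    and x1: "x1 = A *\<^sub>v x + B *\<^sub>v u + \<eta>"
    and l1: "l1 = E1 *\<^sub>v x1 + e1"
    and b: "Y *\<^sub>v b = transpose_mat B *\<^sub>v (E1 *\<^sub>v \<eta> + e1) - transpose_mat N *\<^sub>v \<mu>"
  shows "u = - (minv R *\<^sub>v (transpose_mat B *\<^sub>v l1 - transpose_mat N *\<^sub>v \<mu>)) \<longleftrightarrow>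
    u = - (minv Y *\<^sub>v (transpose_mat B *\<^sub>v (E1 *\<^sub>v (A *\<^sub>v x)))) - b"
proof -
  have minv_R [simp]: "dim_row (minv R) = m" "dim_col (minv R) = m"
    using minv_unit(1)[OF R_unit] by auto
  have [simp]: "dim_vec x1 = n" "dim_vec l1 = n"
    by (simp_all add: x1 l1)
  let ?g = "transpose_mat B *\<^sub>v l1 - transpose_mat N *\<^sub>v \<mu>"
  let ?h = "transpose_mat B *\<^sub>v (E1 *\<^sub>v (A *\<^sub>v x))"
  \<comment> \<open>Both sides expand to R u + B' E1 (A x + B u + eta) + B' e1 - N' mu.\<close>
  have key: "R *\<^sub>v u + ?g = Y *\<^sub>v u + Y *\<^sub>v b + ?h"
    unfolding b unfolding l1 x1
    \<comment> \<open>Without \<open>index_mult_mat_vec\<close> the entries of the products stay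
      atomic, and the claim is linear arithmetic in them.\<close>
    by (rule eq_vecI) (simp_all add: mat_vec_distribs del: index_mult_mat_vec)
  \<comment> \<open>Clearing the inverses turns each control formula into the vanishing of one side
    of \<open>key\<close>.\<close>
  have 1: "u = - (minv R *\<^sub>v ?g) \<longleftrightarrow> R *\<^sub>v (- u) = ?g"
  proof -
    have "u = - (minv R *\<^sub>v ?g) \<longleftrightarrow> minv R *\<^sub>v ?g = - u"
      by (auto simp: vec_eq_iff simp del: index_mult_mat_vec)
    also have "\<dots> \<longleftrightarrow> R *\<^sub>v (- u) = ?g"
      by (rule minv_mult_vec_eq_iff[OF R_unit]) (auto intro: carrier_vecI)
    finally show ?thesis .
  qed
  have 2: "u = - (minv Y *\<^sub>v ?h) - b \<longleftrightarrow> Y *\<^sub>v (- u - b) = ?h"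
  proof -
    have "u = - (minv Y *\<^sub>v ?h) - b \<longleftrightarrow> minv Y *\<^sub>v ?h = - u - b"
      by (auto simp: vec_eq_iff simp del: index_mult_mat_vec)
    also have "\<dots> \<longleftrightarrow> Y *\<^sub>v (- u - b) = ?h"
      by (rule minv_mult_vec_eq_iff[OF Y_unit]) (auto intro: carrier_vecI)
    finally show ?thesis .
  qed
  have 3: "R *\<^sub>v (- u) = ?g \<longleftrightarrow> - (R *\<^sub>v u) = ?g"
    by (simp add: mult_mat_vec_uminus)
  have 4: "Y *\<^sub>v (- u - b) = ?h \<longleftrightarrow> - (Y *\<^sub>v u) - Y *\<^sub>v b = ?h"
    by (simp add: mult_mat_vec_uminus mult_mat_vec_minus)
  have "(R *\<^sub>v u) $ a + ?g $ a = (Y *\<^sub>v u) $ a + (Y *\<^sub>v b) $ a + ?h $ a" if "a < m" for a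
    using arg_cong[OF key, of "\<lambda>v. v $ a"] that by (simp del: index_mult_mat_vec)
  then show ?thesis
    unfolding 1 2 3 4
    by (auto simp add: vec_eq_iff algebra_simps simp del: index_mult_mat_vec)
qed

text \<open>Substituting the feedback law for u yields the closed-loop form used in LCS2; the beta
  terms are absent because they are zero for consistent solutions.\<close>

lemma state_eq:
  assumes [simp]: "dim_vec x = n" "dim_vec \<eta> = n" "dim_vec b = m"
    and u: "u = - (minv Y *\<^sub>v (transpose_mat B *\<^sub>v (E1 *\<^sub>v (A *\<^sub>v x)))) - b"
  shows "A *\<^sub>v x + B *\<^sub>v u + \<eta> =
    ((1\<^sub>m n - B * minv Y * transpose_mat B * E1) * A) *\<^sub>v x - B *\<^sub>v b + \<eta>"
  unfolding u by (rule eq_vecI) (simp_all add: mat_vec_distribs del: index_mult_mat_vec)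

lemma constraint_eq:
  assumes [simp]: "dim_vec x = n" "dim_vec \<alpha> = c" "dim_vec r = c" "dim_vec b = m"
    and u: "u = - (minv Y *\<^sub>v (transpose_mat B *\<^sub>v (E1 *\<^sub>v (A *\<^sub>v x)))) - b"
  shows "M *\<^sub>v x + (N *\<^sub>v u + \<alpha>) + r =
    (M - N * minv Y * transpose_mat B * E1 * A) *\<^sub>v x - N *\<^sub>v b + \<alpha> + r"
  unfolding u by (rule eq_vecI) (simp_all add: mat_vec_distribs del: index_mult_mat_vec)

text \<open>Under the feedback law, A' E1 (A x + B u) is A' E1 A x - A' E1 B Y^-1 B' E1 A x - A' E1
  B b. Its part linear in x, together with Q x, is E0 x by the Riccati equation, and E0 x cancels on
  both sides.\<close>

lemma costate_iff:
  assumes [simp]: "dim_vec x = n" "dim_vec \<eta> = n" "dim_vec b = m" "dim_vec e1 = n" "dim_vec e = n"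
      "dim_vec p = n" "dim_vec \<mu> = c"
    and u: "u = - (minv Y *\<^sub>v (transpose_mat B *\<^sub>v (E1 *\<^sub>v (A *\<^sub>v x)))) - b"
    and x1: "x1 = A *\<^sub>v x + B *\<^sub>v u + \<eta>"
    and l1: "l1 = E1 *\<^sub>v x1 + e1"
  shows "E0 *\<^sub>v x + e = Q *\<^sub>v x + p + transpose_mat A *\<^sub>v l1 - transpose_mat M *\<^sub>v \<mu> \<longleftrightarrow>
    e = transpose_mat A *\<^sub>v e1 + transpose_mat A *\<^sub>v (E1 *\<^sub>v \<eta>)
      - transpose_mat A *\<^sub>v (E1 *\<^sub>v (B *\<^sub>v b)) + p - transpose_mat M *\<^sub>v \<mu>"
    (is "_ = ?rhs1 \<longleftrightarrow> _ = ?rhs2")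
proof -
  have E0x: "E0 *\<^sub>v x = transpose_mat A *\<^sub>v (E1 *\<^sub>v (A *\<^sub>v x)) + Q *\<^sub>v x
      - transpose_mat A *\<^sub>v (E1 *\<^sub>v (B *\<^sub>v (minv Y *\<^sub>v (transpose_mat B *\<^sub>v
          (E1 *\<^sub>v (A *\<^sub>v x))))))"
    by (subst riccati) (simp add: mat_vec_distribs)
  have rhs: "?rhs1 = E0 *\<^sub>v x + ?rhs2"
    unfolding E0x l1 x1 u
    by (rule eq_vecI) (simp_all add: mat_vec_distribs del: index_mult_mat_vec)
  have cancel: "E0 *\<^sub>v x + e = E0 *\<^sub>v x + w \<longleftrightarrow> e = w" if "dim_vec w = n" for w
    using that by (auto simp: vec_eq_iff simp del: index_mult_mat_vec)
  show ?thesis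
    unfolding rhs by (rule cancel) simp
qed

end

section \<open>Corresponding data of the two systems\<close>

lemma eta_of_cong:
  assumes "\<And>j. j \<in> players G \<Longrightarrow> u k j = v k j"
    and "\<And>j. j \<in> players G \<Longrightarrow> dim_row (Bmat G k j) = xdim G"
  shows "eta_of G u k i = eta_of G v k i"
  unfolding eta_of_def by (rule finsum_vec_cong) (use assms in \<open>auto intro!: carrier_vecI\<close>)

lemma alpha_of_cong:
  assumes "\<And>j. j \<in> players G \<Longrightarrow> u k j = v k j"
  shows "alpha_of G u k i = alpha_of G v k i"
  unfolding alpha_of_def
  by (rule finsum_vec_cong) (use assms in \<open>auto simp: Nblock_def intro!: carrier_vecI\<close>)

lemma finite_players: "finite (players G)"
  by (simp add: players_def)

lemma dim_Nblock [simp]: "dim_row (Nblock G k i j) = cdim G i" "dim_col (Nblock G k i j) = udim G j"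
  by (simp_all add: Nblock_def)

text \<open>Consistency makes all multiplier differences zero, so every term of beta is a matrix
  applied to a zero vector; what remains is to check dimensions.\<close>

lemma beta_eq_zero:
  assumes G: "is_dgc G" and k: "k < horizon G" and i: "i \<in> players G"
    and eq: "\<And>k. k < horizon G \<Longrightarrow> mubar k i = mustar k i"
    and dim: "\<And>k. k < horizon G \<Longrightarrow> mustar k i \<in> carrier_vec (cdim G i)"
  shows "beta G mustar mubar k i = 0\<^sub>v (udim G i)"
proof -
  have zero: "X *\<^sub>v (mubar t i - mustar t i) = 0\<^sub>v (dim_row X)"
    if "t < horizon G" "dim_col X = cdim G i" for X :: "real mat" and t
    using eq[OF that(1)] dim[OF that(1)] that(2)
    by (intro eq_vecI) (auto simp: scalar_prod_def)
  have B: "Bmat G k i \<in> carrier_mat (xdim G) (udim G i)"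
    and M: "\<And>t. t < horizon G \<Longrightarrow> Mmat G t i \<in> carrier_mat (cdim G i) (xdim G)"
    using G i k by (auto simp: is_dgc_def)
  have "vsum (udim G i)
      (\<lambda>t. transpose_mat (Aprod G k (t - Suc k) * Bmat G k i) *\<^sub>v
        (transpose_mat (Mmat G t i) *\<^sub>v (mubar t i - mustar t i))) {Suc k..<horizon G} =
    vsum (udim G i) (\<lambda>t. 0\<^sub>v (udim G i)) {Suc k..<horizon G}"
  proof (rule finsum_vec_cong)
    fix t assume t: "t \<in> {Suc k..<horizon G}"
    let ?X = "transpose_mat (Aprod G k (t - Suc k) * Bmat G k i)"
    have "dim_col (Aprod G k d) = xdim G" for d
      using G k by (induction d) (auto simp: is_dgc_def)
    \<comment> \<open>The row dimension comes from the leftmost factor, at time k + d, which has to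
      lie before the horizon; the column dimension comes from the identity at the right end.\<close>
    have "dim_row (Aprod G k d) = xdim G" if "k + d < horizon G" for d
      using G that by (cases d) (auto simp: is_dgc_def)
    then have "?X *\<^sub>v 0\<^sub>v (xdim G) = 0\<^sub>v (udim G i)"
      using t B by (intro eq_vecI) (auto simp: scalar_prod_def)
    then show "?X *\<^sub>v (transpose_mat (Mmat G t i) *\<^sub>v (mubar t i - mustar t i)) = 0\<^sub>v (udim G i)"
      using t M[of t] zero[of t "transpose_mat (Mmat G t i)"] by simp
  qed simp
  then show ?thesis
    using zero[OF k, of "transpose_mat (Nblock G k i i)"] by (simp add: beta_def finsum_vec_zero)
qed

text \<open>Positive definiteness makes R invertible, while invertibility of Y is part of having a
  Riccati solution.\<close>

lemma riccati_stage_of_dgc: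
  assumes "is_dgc G" and "assumption1 G" and "riccati_solution G E"
    and "k < horizon G" and "i \<in> players G"
  shows "riccati_stage (xdim G) (udim G i) (cdim G i) (Amat G k) (Bmat G k i) (E (Suc k) i) (E k i)
    (Qmat G k i) (Rmat G k i i) (Mmat G k i) (Nblock G k i i)"
proof -
  have carr: "Bmat G k i \<in> carrier_mat (xdim G) (udim G i)"
    "Rmat G k i i \<in> carrier_mat (udim G i) (udim G i)"
    using assms(1,4,5) by (auto simp: is_dgc_def)
  have E_carr: "E (Suc k) i \<in> carrier_mat (xdim G) (xdim G)" "E k i \<in> carrier_mat (xdim G) (xdim G)"
    using assms(3-5) unfolding riccati_solution_def by (metis Suc_leI less_imp_le)+
  have Y: "Rmat G k i i + transpose_mat (Bmat G k i) * E (Suc k) i * Bmat G k i = Ymat G E k i"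
    by (simp add: Ymat_def)
  have Ycarr: "Ymat G E k i \<in> carrier_mat (udim G i) (udim G i)"
    unfolding Ymat_def using carr E_carr by auto
  show ?thesis
  proof (unfold_locales, unfold Y)
    show "Ymat G E k i \<in> Units (ring_mat TYPE(real) (udim G i) ())"
      by (rule invertible_mat_unit[OF _ Ycarr]) (use assms in \<open>auto simp: riccati_solution_def\<close>)
    show "Rmat G k i i \<in> Units (ring_mat TYPE(real) (udim G i) ())"
      by (rule positive_definite_unit) (use assms carr in \<open>auto simp: assumption1_def\<close>)
    show "E k i = transpose_mat (Amat G k) * E (Suc k) i * Amat G k + Qmat G k i
        - transpose_mat (Amat G k) * E (Suc k) i * Bmat G k i * minv (Ymat G E k i)
          * transpose_mat (Bmat G k i) * E (Suc k) i * Amat G k"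
      using assms by (simp add: riccati_solution_def)
  qed (use assms(1,4,5) carr E_carr in \<open>auto simp: is_dgc_def Nblock_def\<close>)
qed

section \<open>Equivalence of the two systems for corresponding data\<close>

text \<open>
  The state and the multipliers carry different names in the two systems because they need to
  agree only up to the horizon.
\<close>

locale lcs_pair =
  fixes G :: dgc and E :: "nat \<Rightarrow> nat \<Rightarrow> real mat"
    and x xbar :: "nat \<Rightarrow> real vec" and lam e b mu mubar mustar :: "nat \<Rightarrow> nat \<Rightarrow> real vec"
  assumes dgc: "is_dgc G" and assm1: "assumption1 G" and ric: "riccati_solution G E"
    and x: "k \<le> horizon G \<Longrightarrow> x k \<in> carrier_vec (xdim G)"
    and xbar: "k \<le> horizon G \<Longrightarrow> xbar k = x k"
    and mu: "k < horizon G \<Longrightarrow> i \<in> players G \<Longrightarrow> mu k i \<in> carrier_vec (cdim G i)"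
    and mubar: "k < horizon G \<Longrightarrow> i \<in> players G \<Longrightarrow> mubar k i = mu k i"
    and mustar: "k < horizon G \<Longrightarrow> i \<in> players G \<Longrightarrow> mustar k i = mu k i"
    and e: "k \<le> horizon G \<Longrightarrow> i \<in> players G \<Longrightarrow> e k i \<in> carrier_vec (xdim G)"
    and b: "k \<le> horizon G \<Longrightarrow> i \<in> players G \<Longrightarrow> b k i \<in> carrier_vec (udim G i)"
    and b_end: "i \<in> players G \<Longrightarrow> b (horizon G) i = 0\<^sub>v (udim G i)"
    and lam: "k \<le> horizon G \<Longrightarrow> i \<in> players G \<Longrightarrow> lam k i = E k i *\<^sub>v x k + e k i"
begin

abbreviation "u1 \<equiv> LCS1_control G lam mu"
abbreviation "u2 \<equiv> LCS2_control G E mustar xbar b mubar"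

text \<open>The control is a parameter because eta is formed from the LCS1 control in the derived
  data of part (a) and from the LCS2 control in part (b).\<close>

abbreviation b_equation :: "(nat \<Rightarrow> nat \<Rightarrow> real vec) \<Rightarrow> nat \<Rightarrow> nat \<Rightarrow> bool" where
  "b_equation u k i \<equiv> Ymat G E k i *\<^sub>v b k i =
     transpose_mat (Bmat G k i) *\<^sub>v (E (Suc k) i *\<^sub>v eta_of G u k i + e (Suc k) i)
     - transpose_mat (Nblock G k i i) *\<^sub>v mu k i"

lemma stage:
  assumes "k < horizon G" and "i \<in> players G"
  shows "riccati_stage (xdim G) (udim G i) (cdim G i) (Amat G k) (Bmat G k i) (E (Suc k) i) (E k i)
    (Qmat G k i) (Rmat G k i i) (Mmat G k i) (Nblock G k i i)"
  using riccati_stage_of_dgc[OF dgc assm1 ric assms] .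

lemma stage_dims:
  assumes "k < horizon G" and "i \<in> players G"
  shows "dim_vec (x k) = xdim G" "dim_vec (mu k i) = cdim G i" "dim_vec (b k i) = udim G i"
    "dim_vec (e k i) = xdim G" "dim_vec (e (Suc k) i) = xdim G" "dim_vec (rvec G k i) = cdim G i"
    "dim_vec (pvec G k i) = xdim G" "dim_row (Bmat G k i) = xdim G" "dim_col (Bmat G k i) = udim G i"
proof -
  have "Bmat G k i \<in> carrier_mat (xdim G) (udim G i)" "rvec G k i \<in> carrier_vec (cdim G i)"
    "pvec G k i \<in> carrier_vec (xdim G)"
    using assms dgc by (simp_all add: is_dgc_def)
  then show "dim_vec (x k) = xdim G" "dim_vec (mu k i) = cdim G i" "dim_vec (b k i) = udim G i"
    "dim_vec (e k i) = xdim G" "dim_vec (e (Suc k) i) = xdim G" "dim_vec (rvec G k i) = cdim G i"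
    "dim_vec (pvec G k i) = xdim G" "dim_row (Bmat G k i) = xdim G" "dim_col (Bmat G k i) = udim G i"
    using assms x[of k] mu[of k i] b[of k i] e[of k i] e[of "Suc k" i] by auto
qed

lemma eta_dim: "k < horizon G \<Longrightarrow> dim_vec (eta_of G u k i) = xdim G"
  unfolding eta_of_def by (rule dim_finsum_vec) (use stage_dims(8) in \<open>auto intro!: carrier_vecI\<close>)

lemma alpha_dim: "dim_vec (alpha_of G u k i) = cdim G i"
  unfolding alpha_of_def by (rule dim_finsum_vec) (auto intro!: carrier_vecI)

lemma sum_B:
  assumes "k < horizon G" and "i \<in> players G"
  shows "vsum (xdim G) (\<lambda>j. Bmat G k j *\<^sub>v u k j) (players G)
    = Bmat G k i *\<^sub>v u k i + eta_of G u k i"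
  unfolding eta_of_def
  by (rule finsum_vec_remove[OF finite_players assms(2)])
     (use stage_dims(8,9)[OF assms(1)] in \<open>auto intro!: carrier_vecI\<close>)

lemma sum_N:
  assumes "i \<in> players G"
  shows "vsum (cdim G i) (\<lambda>j. Nblock G k i j *\<^sub>v u k j) (players G)
    = Nblock G k i i *\<^sub>v u k i + alpha_of G u k i"
  unfolding alpha_of_def
  by (rule finsum_vec_remove[OF finite_players assms]) (auto intro!: carrier_vecI)

lemma u1_dim:
  assumes "k < horizon G" and "i \<in> players G"
  shows "dim_vec (u1 k i) = udim G i"
proof -
  interpret riccati_stage "xdim G" "udim G i" "cdim G i" "Amat G k" "Bmat G k i" "E (Suc k) i" "E k i"
    "Qmat G k i" "Rmat G k i i" "Mmat G k i" "Nblock G k i i"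
    using stage[OF assms] .
  show ?thesis
    using minv_unit(1)[OF R_unit] by (simp add: LCS1_control_def)
qed

text \<open>Since beta is zero here, only the feedback term and \<open>b\<close> are left of the
  LCS2 control.\<close>

lemma u2_eq:
  assumes "k < horizon G" and "i \<in> players G"
  shows "u2 k i = - (minv (Ymat G E k i) *\<^sub>v (transpose_mat (Bmat G k i) *\<^sub>v
      (E (Suc k) i *\<^sub>v (Amat G k *\<^sub>v x k)))) - b k i"
    and "minv (Ymat G E k i) *\<^sub>v beta G mustar mubar k i = 0\<^sub>v (udim G i)"
proof -
  interpret riccati_stage "xdim G" "udim G i" "cdim G i" "Amat G k" "Bmat G k i" "E (Suc k) i" "E k i"
    "Qmat G k i" "Rmat G k i i" "Mmat G k i" "Nblock G k i i"
    using stage[OF assms] .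
  have beta: "beta G mustar mubar k i = 0\<^sub>v (udim G i)"
    by (rule beta_eq_zero[OF dgc assms]) (use assms(2) mu mubar mustar in simp_all)
  show minv_beta: "minv (Ymat G E k i) *\<^sub>v beta G mustar mubar k i = 0\<^sub>v (udim G i)"
    unfolding beta using minv_Y by (intro eq_vecI) (auto simp: Ymat_def)
  show "u2 k i = - (minv (Ymat G E k i) *\<^sub>v (transpose_mat (Bmat G k i) *\<^sub>v
      (E (Suc k) i *\<^sub>v (Amat G k *\<^sub>v x k)))) - b k i"
    unfolding LCS2_control_def minv_beta
    using assms xbar[of k] stage_dims[OF assms]
    by (intro eq_vecI) (simp_all del: index_mult_mat_vec)
qed

lemma u2_dim:
  assumes "k < horizon G" and "i \<in> players G"
  shows "dim_vec (u2 k i) = udim G i"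
  using u2_eq(1)[OF assms] stage_dims(3)[OF assms] by simp

text \<open>This is \<open>control_iff\<close> for the game data. With \<open>u\<close> left open,
  the choice \<open>u1\<close> or \<open>u2\<close> makes one side of the equivalence trivial and
  yields the other.\<close>

lemma controls_agree:
  assumes k: "k < horizon G" and i: "i \<in> players G"
    and u: "dim_vec (u k i) = udim G i"
    and x1: "x (Suc k) = Amat G k *\<^sub>v x k + (Bmat G k i *\<^sub>v u k i + eta_of G u k i)"
    and b_eq: "b_equation u k i"
  shows "u k i = u1 k i \<longleftrightarrow> u k i = u2 k i"
proof -
  interpret riccati_stage "xdim G" "udim G i" "cdim G i" "Amat G k" "Bmat G k i" "E (Suc k) i" "E k i"
    "Qmat G k i" "Rmat G k i i" "Mmat G k i" "Nblock G k i i"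
    using stage[OF k i] .
  have [simp]: "dim_vec (x k) = xdim G" "dim_vec (eta_of G u k i) = xdim G"
    using stage_dims[OF k i] eta_dim[OF k] by auto
  have x1': "x (Suc k) = Amat G k *\<^sub>v x k + Bmat G k i *\<^sub>v u k i + eta_of G u k i"
    unfolding x1 by (rule eq_vecI) (simp_all del: index_mult_mat_vec)
  show ?thesis
    unfolding u2_eq(1)[OF k i] unfolding LCS1_control_def Ymat_def
    by (rule control_iff[OF _ u _ _ _ _ x1' lam])
       (use k i stage_dims[OF k i] b_eq in \<open>simp_all add: Ymat_def\<close>)
qed

text \<open>The vectors \<open>w j\<close> are the negated LCS1 controls. Moving the sign into the
  sum and splitting off player i gives the own-control-plus-others form that LCS2 uses.\<close>

lemma LCS1_sums:
  assumes k: "k < horizon G" and i: "i \<in> players G"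
  defines "w \<equiv> \<lambda>j. minv (Rmat G k j j) *\<^sub>v (transpose_mat (Bmat G k j) *\<^sub>v lam (Suc k) j
                - transpose_mat (Nblock G k j j) *\<^sub>v mu k j)"
  shows "Amat G k *\<^sub>v x k - vsum (xdim G) (\<lambda>j. Bmat G k j *\<^sub>v w j) (players G)
      = Amat G k *\<^sub>v x k + (Bmat G k i *\<^sub>v u1 k i + eta_of G u1 k i)" (is ?B)
    and "Mmat G k i *\<^sub>v x k - vsum (cdim G i) (\<lambda>j. Nblock G k i j *\<^sub>v w j) (players G) + rvec G k i
      = Mmat G k i *\<^sub>v x k + (Nblock G k i i *\<^sub>v u1 k i + alpha_of G u1 k i) + rvec G k i" (is ?N)
proof -
  have u1: "u1 k j = - w j" for j
    by (simp add: LCS1_control_def w_def)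
  have w_dim: "dim_vec (w j) = udim G j" if "j \<in> players G" for j
    using u1_dim[OF k that] by (simp add: u1)
  have neg: "X *\<^sub>v u1 k j = - (X *\<^sub>v w j)" if "j \<in> players G" "dim_col X = udim G j" for X j
    unfolding u1 by (rule mult_mat_vec_uminus) (simp add: w_dim that)
  have B: "\<And>j. j \<in> players G \<Longrightarrow> Bmat G k j *\<^sub>v w j \<in> carrier_vec (xdim G)"
    using stage_dims(8,9)[OF k] by (auto intro!: carrier_vecI)
  have N: "\<And>j. j \<in> players G \<Longrightarrow> Nblock G k i j *\<^sub>v w j \<in> carrier_vec (cdim G i)"
    by (auto intro!: carrier_vecI)
  have "vsum (xdim G) (\<lambda>j. Bmat G k j *\<^sub>v u1 k j) (players G)
      = vsum (xdim G) (\<lambda>j. - (Bmat G k j *\<^sub>v w j)) (players G)"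
    by (rule finsum_vec_cong) (use neg stage_dims(8,9)[OF k] in \<open>auto intro!: carrier_vecI\<close>)
  also have "\<dots> = - vsum (xdim G) (\<lambda>j. Bmat G k j *\<^sub>v w j) (players G)"
    by (rule finsum_vec_uminus[OF finite_players B])
  finally show ?B
    unfolding sum_B[OF k i, symmetric] by (auto simp del: index_mult_mat_vec)
  have "vsum (cdim G i) (\<lambda>j. Nblock G k i j *\<^sub>v u1 k j) (players G)
      = vsum (cdim G i) (\<lambda>j. - (Nblock G k i j *\<^sub>v w j)) (players G)"
    by (rule finsum_vec_cong) (use neg in \<open>auto intro!: carrier_vecI\<close>)
  also have "\<dots> = - vsum (cdim G i) (\<lambda>j. Nblock G k i j *\<^sub>v w j) (players G)"
    by (rule finsum_vec_uminus[OF finite_players N])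
  finally show ?N
    unfolding sum_N[OF i, symmetric] using stage_dims(6)[OF k i]
    by (intro eq_vecI) (simp_all add: dim_finsum_vec[OF N] del: index_mult_mat_vec)
qed

text \<open>The right-hand sides are those of \<open>LCS1_sums\<close> with \<open>u2\<close> in
  place of \<open>u1\<close>, so the two systems can be compared as soon as the controls
  agree.\<close>

lemma LCS2_sums:
  assumes k: "k < horizon G" and i: "i \<in> players G"
  shows "((1\<^sub>m (xdim G) - Bmat G k i * minv (Ymat G E k i) * transpose_mat (Bmat G k i) * E (Suc k) i)
        * Amat G k) *\<^sub>v xbar k - Bmat G k i *\<^sub>v b k i
      + Bmat G k i *\<^sub>v (minv (Ymat G E k i) *\<^sub>v beta G mustar mubar k i) + eta_of G u2 k i
      = Amat G k *\<^sub>v x k + (Bmat G k i *\<^sub>v u2 k i + eta_of G u2 k i)" (is "?lhs1 = ?rhs1")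
    and "Nblock G k i i *\<^sub>v (minv (Ymat G E k i) *\<^sub>v beta G mustar mubar k i)
      + (Mmat G k i - Nblock G k i i * minv (Ymat G E k i) * transpose_mat (Bmat G k i) * E (Suc k) i
          * Amat G k) *\<^sub>v xbar k
      - Nblock G k i i *\<^sub>v b k i + alpha_of G u2 k i + rvec G k i
      = Mmat G k i *\<^sub>v x k + (Nblock G k i i *\<^sub>v u2 k i + alpha_of G u2 k i) + rvec G k i"
      (is "?lhs2 = ?rhs2")
proof -
  interpret riccati_stage "xdim G" "udim G i" "cdim G i" "Amat G k" "Bmat G k i" "E (Suc k) i" "E k i"
    "Qmat G k i" "Rmat G k i i" "Mmat G k i" "Nblock G k i i"
    using stage[OF k i] .
  note [simp] = stage_dims[OF k i] eta_dim[OF k] alpha_dim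
  note u2' = u2_eq(1)[OF k i, unfolded Ymat_def]
  have xb: "xbar k = x k"
    using xbar k by simp
  have "?lhs1 = Amat G k *\<^sub>v x k + Bmat G k i *\<^sub>v u2 k i + eta_of G u2 k i"
    unfolding xb u2_eq(2)[OF k i] unfolding Ymat_def
    by (subst state_eq[OF _ _ _ u2'])
       (simp_all add: mult_mat_vec_zero, rule eq_vecI, simp_all del: index_mult_mat_vec)
  also have "\<dots> = ?rhs1"
    by (rule eq_vecI) (simp_all del: index_mult_mat_vec)
  finally show "?lhs1 = ?rhs1" .
  show "?lhs2 = ?rhs2"
    unfolding xb u2_eq(2)[OF k i] unfolding Ymat_def
    by (subst constraint_eq[OF _ _ _ _ u2'])
       (simp_all add: mult_mat_vec_zero, rule eq_vecI, simp_all del: index_mult_mat_vec)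
qed

text \<open>With equal controls the state and complementarity conditions coincide, and the equation
  for \<open>b\<close> is given; only the costate equations need an argument.\<close>

lemma stage_iff:
  assumes u: "\<And>j. j \<in> players G \<Longrightarrow> u1 k j = u2 k j"
    and b_eq: "b_equation u2 k i"
    and k: "k < horizon G" and i: "i \<in> players G"
  shows
    "x (Suc k) = Amat G k *\<^sub>v x k
          - vsum (xdim G) (\<lambda>j. Bmat G k j *\<^sub>v (minv (Rmat G k j j) *\<^sub>v
              (transpose_mat (Bmat G k j) *\<^sub>v lam (Suc k) j
               - transpose_mat (Nblock G k j j) *\<^sub>v mu k j))) (players G) \<and>
        lam k i = Qmat G k i *\<^sub>v x k + pvec G k i + transpose_mat (Amat G k) *\<^sub>v lam (Suc k) i
          - transpose_mat (Mmat G k i) *\<^sub>v mu k i \<and>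
        perp_nonneg (cdim G i)
          (Mmat G k i *\<^sub>v x k
           - vsum (cdim G i) (\<lambda>j. Nblock G k i j *\<^sub>v (minv (Rmat G k j j) *\<^sub>v
               (transpose_mat (Bmat G k j) *\<^sub>v lam (Suc k) j
                - transpose_mat (Nblock G k j j) *\<^sub>v mu k j))) (players G)
           + rvec G k i)
          (mu k i) \<longleftrightarrow>
      xbar (Suc k) =
            ((1\<^sub>m (xdim G) - Bmat G k i * minv (Ymat G E k i) * transpose_mat (Bmat G k i)
              * E (Suc k) i) * Amat G k) *\<^sub>v xbar k
            - Bmat G k i *\<^sub>v b k i + Bmat G k i *\<^sub>v (minv (Ymat G E k i) *\<^sub>v beta G mustar mubar k i)
            + eta_of G u2 k i \<and>
          e k i =
            transpose_mat (Amat G k) *\<^sub>v e (Suc k) i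
            + transpose_mat (Amat G k) *\<^sub>v (E (Suc k) i *\<^sub>v eta_of G u2 k i)
            - transpose_mat (Amat G k) *\<^sub>v (E (Suc k) i *\<^sub>v (Bmat G k i *\<^sub>v b k i)) + pvec G k i
            - transpose_mat (Mmat G k i) *\<^sub>v mustar k i \<and>
          perp_nonneg (cdim G i)
            (Nblock G k i i *\<^sub>v (minv (Ymat G E k i) *\<^sub>v beta G mustar mubar k i)
             + (Mmat G k i - Nblock G k i i * minv (Ymat G E k i) * transpose_mat (Bmat G k i)
                * E (Suc k) i * Amat G k) *\<^sub>v xbar k
             - Nblock G k i i *\<^sub>v b k i + alpha_of G u2 k i + rvec G k i)
            (mubar k i) \<and>
          Ymat G E k i *\<^sub>v b k i =
            transpose_mat (Bmat G k i) *\<^sub>v (E (Suc k) i *\<^sub>v eta_of G u2 k i + e (Suc k) i)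
            - transpose_mat (Nblock G k i i) *\<^sub>v mustar k i"
proof -
  interpret riccati_stage "xdim G" "udim G i" "cdim G i" "Amat G k" "Bmat G k i" "E (Suc k) i" "E k i"
    "Qmat G k i" "Rmat G k i i" "Mmat G k i" "Nblock G k i i"
    using stage[OF k i] .
  have eta: "eta_of G u1 k i = eta_of G u2 k i"
    by (rule eta_of_cong) (use u stage_dims(8)[OF k] in auto)
  have alpha: "alpha_of G u1 k i = alpha_of G u2 k i"
    by (rule alpha_of_cong) (rule u)
  have xb: "xbar (Suc k) = x (Suc k)"
    using xbar k by simp
  let ?x1 = "Amat G k *\<^sub>v x k + (Bmat G k i *\<^sub>v u2 k i + eta_of G u2 k i)"
  have x1: "?x1 = Amat G k *\<^sub>v x k + Bmat G k i *\<^sub>v u2 k i + eta_of G u2 k i"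
    using stage_dims[OF k i] eta_dim[OF k] by (intro eq_vecI) (simp_all del: index_mult_mat_vec)
  \<comment> \<open>The equivalence is conditional on the state equation, which is available as the
    first conjunct on either side.\<close>
  have costate: "lam k i = Qmat G k i *\<^sub>v x k + pvec G k i + transpose_mat (Amat G k) *\<^sub>v lam (Suc k) i
        - transpose_mat (Mmat G k i) *\<^sub>v mu k i \<longleftrightarrow>
      e k i = transpose_mat (Amat G k) *\<^sub>v e (Suc k) i
          + transpose_mat (Amat G k) *\<^sub>v (E (Suc k) i *\<^sub>v eta_of G u2 k i)
          - transpose_mat (Amat G k) *\<^sub>v (E (Suc k) i *\<^sub>v (Bmat G k i *\<^sub>v b k i)) + pvec G k i
          - transpose_mat (Mmat G k i) *\<^sub>v mu k i" if x1': "x (Suc k) = ?x1"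
    unfolding lam[OF less_imp_le[OF k] i]
    by (rule costate_iff[OF _ _ _ _ _ _ _ u2_eq(1)[OF k i, unfolded Ymat_def] x1'[unfolded x1]])
       (use k i stage_dims[OF k i] eta_dim[OF k] lam[of "Suc k" i] in simp_all)
  show ?thesis
    unfolding LCS1_sums[OF k i] LCS2_sums[OF k i] eta alpha u[OF i] xb mubar[OF k i] mustar[OF k i]
    using costate b_eq by blast
qed

lemma lcs_iff:
  assumes u: "\<And>k j. k < horizon G \<Longrightarrow> j \<in> players G \<Longrightarrow> u1 k j = u2 k j"
    and b_eq: "\<And>k i. k < horizon G \<Longrightarrow> i \<in> players G \<Longrightarrow> b_equation u2 k i"
  shows "LCS1_solution G x0 x lam mu \<longleftrightarrow> LCS2_solution G E x0 mustar xbar e b mubar"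
proof -
  have E_carr: "E k i \<in> carrier_mat (xdim G) (xdim G)" if "k \<le> horizon G" "i \<in> players G" for k i
    using ric that by (simp add: riccati_solution_def)
  have carr: "\<forall>k\<le>horizon G. x k \<in> carrier_vec (xdim G)"
    "\<forall>k\<le>horizon G. xbar k \<in> carrier_vec (xdim G)"
    "\<forall>k\<le>horizon G. \<forall>i\<in>players G. lam k i \<in> carrier_vec (xdim G)"
    "\<forall>k\<le>horizon G. \<forall>i\<in>players G. e k i \<in> carrier_vec (xdim G)"
    "\<forall>k\<le>horizon G. \<forall>i\<in>players G. b k i \<in> carrier_vec (udim G i)"
    "\<forall>k<horizon G. \<forall>i\<in>players G. mu k i \<in> carrier_vec (cdim G i)"
    "\<forall>k<horizon G. \<forall>i\<in>players G. mubar k i \<in> carrier_vec (cdim G i)"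
    "\<forall>k<horizon G. \<forall>i\<in>players G. mustar k i \<in> carrier_vec (cdim G i)"
    "\<forall>i\<in>players G. b (horizon G) i = 0\<^sub>v (udim G i)"
    using x xbar e b mu mubar mustar b_end
    by (simp_all add: lam add_carrier_vec mult_mat_vec_carrier[OF E_carr])
  have x_start: "xbar 0 = x 0"
    by (rule xbar) simp
  \<comment> \<open>Here E_K = Q_K, so Q_K x_K cancels from lambda_K = E_K x_K + e_K.\<close>
  have terminal: "lam (horizon G) i = Qmat G (horizon G) i *\<^sub>v x (horizon G) + pvec G (horizon G) i
      \<longleftrightarrow> e (horizon G) i = pvec G (horizon G) i" if i: "i \<in> players G" for i
  proof -
    have "E (horizon G) i = Qmat G (horizon G) i" "pvec G (horizon G) i \<in> carrier_vec (xdim G)"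
      using ric dgc i by (auto simp: riccati_solution_def is_dgc_def)
    then show ?thesis
      using lam[OF order.refl i] e[OF order.refl i] E_carr[OF order.refl i]
      by (auto simp: vec_eq_iff simp del: index_mult_mat_vec)
  qed
  show ?thesis
    unfolding LCS1_solution_def LCS2_solution_def Let_def x_start
    using carr terminal
    \<comment> \<open>The congruence rules supply the index ranges of k and i that
      \<open>stage_iff\<close> requires.\<close>
    by (simp only: simp_thms ball_triv stage_iff[OF u b_eq] cong: ball_cong imp_cong)
qed

end

section \<open>The two directions of the correspondence\<close>

theorem corollary1:
  fixes G :: dgc and E :: "nat \<Rightarrow> nat \<Rightarrow> real mat" and x0 :: "real vec"
  assumes "is_dgc G"
    and "assumption1 G"
    and "riccati_solution G E"
    and "x0 \<in> X0set G"
  shows "(\<forall>x lam mu xbar e b mubar.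
            LCS1_solution G x0 x lam mu \<longrightarrow>
            LCS2_derived_from_LCS1 G E x lam mu xbar e b mubar \<longrightarrow>
            LCS2_consistent_solution G E x0 mu xbar e b mubar \<and>
            (\<forall>k<horizon G. \<forall>i\<in>players G.
               LCS1_control G lam mu k i = LCS2_control G E mu xbar b mubar k i))
       \<and> (\<forall>mustar xbar e b mubar x lam mu.
            LCS2_consistent_solution G E x0 mustar xbar e b mubar \<longrightarrow>
            LCS1_derived_from_LCS2 G E xbar e mubar x lam mu \<longrightarrow>
            LCS1_solution G x0 x lam mu \<and>
            (\<forall>k<horizon G. \<forall>i\<in>players G.
               LCS2_control G E mustar xbar b mubar k i = LCS1_control G lam mu k i))"
proof (rule conjI; intro allI impI)
  fix x lam mu xbar e b mubar
  assume sol: "LCS1_solution G x0 x lam mu"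
    and der: "LCS2_derived_from_LCS1 G E x lam mu xbar e b mubar"
  have E_carr: "E k i \<in> carrier_mat (xdim G) (xdim G)" if "k \<le> horizon G" "i \<in> players G" for k i
    using assms(3) that by (simp add: riccati_solution_def)
  note stage = riccati_stage_of_dgc[OF assms(1-3)]
  have minv_Y: "minv (Ymat G E k i) \<in> carrier_mat (udim G i) (udim G i)"
    if "k < horizon G" "i \<in> players G" for k i
    using riccati_stage.minv_Y[OF stage[OF that]] by (simp add: Ymat_def)
  \<comment> \<open>Before the horizon the dimension of \<open>b\<close> is the row dimension of the
    inverse of Y; at the horizon \<open>b\<close> is zero by definition.\<close>
  have b_carr: "b k i \<in> carrier_vec (udim G i)" if "k \<le> horizon G" "i \<in> players G" for k i
    using der that minv_Y[of k i]
    by (cases "k = horizon G") (auto simp: LCS2_derived_from_LCS1_def intro!: carrier_vecI)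
  have sol_carr: "\<forall>k\<le>horizon G. x k \<in> carrier_vec (xdim G)"
    "\<forall>k\<le>horizon G. \<forall>i\<in>players G. lam k i \<in> carrier_vec (xdim G)"
    "\<forall>k<horizon G. \<forall>i\<in>players G. mu k i \<in> carrier_vec (cdim G i)"
    using sol unfolding LCS1_solution_def by blast+
  have der_eqs: "\<forall>k\<le>horizon G. xbar k = x k"
    "\<forall>k<horizon G. \<forall>i\<in>players G. mubar k i = mu k i"
    "\<forall>k\<le>horizon G. \<forall>i\<in>players G. e k i = lam k i - E k i *\<^sub>v x k"
    "\<forall>i\<in>players G. b (horizon G) i = 0\<^sub>v (udim G i)"
    using der unfolding LCS2_derived_from_LCS1_def by blast+
  interpret lcs_pair G E x xbar lam e b mu mubar mu
  proof
    fix k i assume k: "k \<le> horizon G" and i: "i \<in> players G"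
    then have "x k \<in> carrier_vec (xdim G)" "lam k i \<in> carrier_vec (xdim G)"
      using sol_carr by blast+
    moreover have "e k i = lam k i - E k i *\<^sub>v x k"
      using der_eqs(3) k i by blast
    ultimately show "e k i \<in> carrier_vec (xdim G)" "lam k i = E k i *\<^sub>v x k + e k i"
      using E_carr[OF k i] by (auto simp del: index_mult_mat_vec)
  qed (use assms(1-3) sol_carr der_eqs b_carr in simp_all)
  \<comment> \<open>The derived \<open>b\<close> is given through the inverse of Y; multiplying by Y
    gives the equation, still with eta formed from the LCS1 controls.\<close>
  have b_eq1: "b_equation u1 k i" if k: "k < horizon G" and i: "i \<in> players G" for k i
  proof -
    let ?r = "transpose_mat (Bmat G k i) *\<^sub>v (E (Suc k) i *\<^sub>v eta_of G u1 k i + e (Suc k) i)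
     - transpose_mat (Nblock G k i i) *\<^sub>v mu k i"
    have "minv (Ymat G E k i) *\<^sub>v ?r = b k i"
      using der k i by (simp add: LCS2_derived_from_LCS1_def)
    moreover have "?r \<in> carrier_vec (udim G i)"
      by (rule carrier_vecI) simp
    ultimately show ?thesis
      using minv_mult_vec_eq_iff[OF riccati_stage.Y_unit[OF stage[OF k i]], of "b k i" ?r]
        b_carr[of k i] k i by (simp add: Ymat_def)
  qed
  have u: "u1 k i = u2 k i" if k: "k < horizon G" and i: "i \<in> players G" for k i
  proof -
    have "x (Suc k) = Amat G k *\<^sub>v x k + (Bmat G k i *\<^sub>v u1 k i + eta_of G u1 k i)"
      unfolding LCS1_sums(1)[OF k i, symmetric] using sol k i by (simp add: LCS1_solution_def)
    then show ?thesis
      using controls_agree[OF k i u1_dim[OF k i] _ b_eq1[OF k i]] by simp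
  qed
  \<comment> \<open>Equal controls give equal eta, which turns the equation into the one that LCS2
    demands.\<close>
  have "b_equation u2 k i" if k: "k < horizon G" and i: "i \<in> players G" for k i
  proof -
    have "eta_of G u1 k i = eta_of G u2 k i"
      by (rule eta_of_cong) (use u[OF k] stage_dims(8)[OF k] in auto)
    then show ?thesis
      using b_eq1[OF k i] by simp
  qed
  then show "LCS2_consistent_solution G E x0 mu xbar e b mubar \<and>
      (\<forall>k<horizon G. \<forall>i\<in>players G. u1 k i = u2 k i)"
    using lcs_iff[OF u] sol u mubar by (simp add: LCS2_consistent_solution_def)
next
  fix mustar xbar e b mubar x lam mu
  assume sol: "LCS2_consistent_solution G E x0 mustar xbar e b mubar"
    and der: "LCS1_derived_from_LCS2 G E xbar e mubar x lam mu"
  have sol2: "LCS2_solution G E x0 mustar xbar e b mubar"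
    using sol by (simp add: LCS2_consistent_solution_def)
  have sol_carr: "\<forall>k\<le>horizon G. xbar k \<in> carrier_vec (xdim G)"
    "\<forall>k\<le>horizon G. \<forall>i\<in>players G. e k i \<in> carrier_vec (xdim G)"
    "\<forall>k\<le>horizon G. \<forall>i\<in>players G. b k i \<in> carrier_vec (udim G i)"
    "\<forall>k<horizon G. \<forall>i\<in>players G. mubar k i \<in> carrier_vec (cdim G i)"
    "\<forall>i\<in>players G. b (horizon G) i = 0\<^sub>v (udim G i)"
    "\<forall>k<horizon G. \<forall>i\<in>players G. mustar k i = mubar k i"
    using sol unfolding LCS2_consistent_solution_def LCS2_solution_def by (blast | simp)+
  have der_eqs: "\<forall>k\<le>horizon G. x k = xbar k"
    "\<forall>k<horizon G. \<forall>i\<in>players G. mu k i = mubar k i"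
    "\<forall>k\<le>horizon G. \<forall>i\<in>players G. lam k i = E k i *\<^sub>v xbar k + e k i"
    using der unfolding LCS1_derived_from_LCS2_def by blast+
  interpret lcs_pair G E x xbar lam e b mu mubar mustar
    by unfold_locales (use assms(1-3) sol_carr der_eqs in simp_all)
  have b_eq: "b_equation u2 k i" if k: "k < horizon G" and i: "i \<in> players G" for k i
    using sol2 k i mustar[OF k i] by (simp add: LCS2_solution_def Let_def)
  \<comment> \<open>Now the LCS2 control generates the next state, so \<open>controls_agree\<close>
    is used in the opposite direction.\<close>
  have u: "u1 k i = u2 k i" if k: "k < horizon G" and i: "i \<in> players G" for k i
  proof -
    have "xbar (Suc k) = Amat G k *\<^sub>v x k + (Bmat G k i *\<^sub>v u2 k i + eta_of G u2 k i)"
      unfolding LCS2_sums(1)[OF k i, symmetric]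
      using sol2 k i by (simp add: LCS2_solution_def Let_def)
    then show ?thesis
      using controls_agree[OF k i u2_dim[OF k i] _ b_eq[OF k i]] xbar[of "Suc k"] k by simp
  qed
  show "LCS1_solution G x0 x lam mu \<and> (\<forall>k<horizon G. \<forall>i\<in>players G. u2 k i = u1 k i)"
    using lcs_iff[OF u b_eq] sol2 u by simp
qed

end
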